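(* Let $n\ge1$ and let $A=(a_{ij})\in\mathrm{CSP}_{\mathbb{Z}}(n)$. Then there exist a finite set $X$ with an action of $C_n$ and a statistic $\tau:X\to\mathbb{N}$ such that $(X,C_n,\tau)$ exhibits the cyclic sieving phenomenon and $A_{(X,C_n,\tau)}=A$.
   Context: Rows of $n\times n$ matrices are indexed by $i=0,\dots,n-1$ and columns by $j=1,\dots,n$. Let $\omega_n$ be a fixed primitive $n$-th root of unity. A matrix $A=(a_{ij})\in\mathbb{R}_{\ge 0}^{n\times n}$ is a CSP-matrix if for each $1\le k\le n$, $$\sum_{\substack{0\le i<n\\1\le j\le n}}a_{ij}\,\omega_n^{ki}=\sum_{0\le i<n}\ \sum_{j\mid k}a_{ij}.$$ $\mathrm{CSP}(n)$ is the set of all $n\times n$ CSP-matrices and $\mathrm{CSP}_{\mathbb{Z}}(n)=\mathrm{CSP}(n)\cap\mathbb{Z}^{n\times n}$. Let $C_n$ be a cyclic group of order $n$ generated by $\sigma_n$ acting on a finite set $X$, and let $\tau:X\to\mathbb{N}$. The triple $(X,C_n,\tau)$ exhibits the cyclic sieving phenomenon if, with $f_\tau(q)=\sum_{x\in X}q^{\tau(x)}$, one has $f_\tau(\omega_n^k)=|\{x\in X:\sigma_n^k\cdot x=x\}|$ for all $k\in\mathbb{Z}$. The matrix $A_{(X,C_n,\tau)}=(a_{ij})$ is defined by letting $a_{ij}$ be the number of $x\in X$ with $\tau(x)\equiv i \pmod n$ and $o(x)=j$, where $o(x)=\min\{j\in\{1,\dots,n\}:\sigma_n^j\cdot x=x\}$.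 *)

theory Defs
  imports Complex_Main "HOL-Algebra.Group_Action" "HOL-Algebra.Generated_Groups"
begin

definition primitive_unity_root :: "nat \<Rightarrow> complex \<Rightarrow> bool" where
  "primitive_unity_root n \<omega> \<longleftrightarrow> n \<ge> 1 \<and> \<omega> ^ n = 1 \<and> (\<forall>m. 1 \<le> m \<and> m < n \<longrightarrow> \<omega> ^ m \<noteq> 1)"

(* An n x n matrix is an extensional function on its index set (rows from 0, columns from 1),
   so that equality of functions is equality of matrices. *)

definition mat_index :: "nat \<Rightarrow> (nat \<times> nat) set" where
  "mat_index n = {0..<n} \<times> {1..n}"

definition CSP :: "nat \<Rightarrow> complex \<Rightarrow> (nat \<times> nat \<Rightarrow> real) set" where
  "CSP n \<omega> = {A \<in> mat_index n \<rightarrow>\<^sub>E {0..}.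
     \<forall>k\<in>{1..n}.
       (\<Sum>(i, j)\<in>mat_index n. complex_of_real (A (i, j)) * \<omega> ^ (k * i)) =
       complex_of_real (\<Sum>i\<in>{0..<n}. \<Sum>j\<in>{j \<in> {1..n}. j dvd k}. A (i, j))}"

definition CSP_int :: "nat \<Rightarrow> complex \<Rightarrow> (nat \<times> nat \<Rightarrow> real) set" where
  "CSP_int n \<omega> = CSP n \<omega> \<inter> (mat_index n \<rightarrow>\<^sub>E \<int>)"

definition stat_gf :: "'x set \<Rightarrow> ('x \<Rightarrow> nat) \<Rightarrow> complex \<Rightarrow> complex" where
  "stat_gf X \<tau> q = (\<Sum>x\<in>X. q ^ \<tau> x)"

definition cyclic_gen :: "('g, 'b) monoid_scheme \<Rightarrow> 'g \<Rightarrow> nat \<Rightarrow> bool" where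
  "cyclic_gen C \<sigma> n \<longleftrightarrow>
     group C \<and> order C = n \<and> \<sigma> \<in> carrier C \<and> carrier C = generate C {\<sigma>}"

(* \<omega> is meant to be a primitive n-th root of unity and \<sigma> a generator of C, where n is the
   order of C; neither is asserted here. *)
definition exhibits_csp ::
  "complex \<Rightarrow> ('g, 'b) monoid_scheme \<Rightarrow> 'g \<Rightarrow> 'x set \<Rightarrow> ('g \<Rightarrow> 'x \<Rightarrow> 'x) \<Rightarrow> ('x \<Rightarrow> nat) \<Rightarrow> bool" where
  "exhibits_csp \<omega> C \<sigma> X \<phi> \<tau> \<longleftrightarrow>
     finite X \<and> group_action C X \<phi> \<and>
     (\<forall>k::int. stat_gf X \<tau> (\<omega> powi k) = of_nat (card (invariants X \<phi> (\<sigma> [^]\<^bsub>C\<^esub> k))))"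

definition orbit_len ::
  "nat \<Rightarrow> ('g, 'b) monoid_scheme \<Rightarrow> 'g \<Rightarrow> ('g \<Rightarrow> 'x \<Rightarrow> 'x) \<Rightarrow> 'x \<Rightarrow> nat" where
  "orbit_len n C \<sigma> \<phi> x = Min {j \<in> {1..n}. \<phi> (\<sigma> [^]\<^bsub>C\<^esub> j) x = x}"

definition csp_matrix ::
  "nat \<Rightarrow> ('g, 'b) monoid_scheme \<Rightarrow> 'g \<Rightarrow> 'x set \<Rightarrow> ('g \<Rightarrow> 'x \<Rightarrow> 'x) \<Rightarrow> ('x \<Rightarrow> nat)
     \<Rightarrow> nat \<times> nat \<Rightarrow> real" where
  "csp_matrix n C \<sigma> X \<phi> \<tau> = (\<lambda>(i, j)\<in>mat_index n.
     real (card {x \<in> X. \<tau> x mod n = i mod n \<and> orbit_len n C \<sigma> \<phi> x = j}))"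

end

theory Submission
  imports Defs "HOL-Library.Nat_Bijection" "HOL-Algebra.Multiplicative_Group"
begin

text \<open>
  Write \<open>r i\<close> and \<open>c j\<close> for the row and column sums of the matrix. The defining condition is
  \<open>f (\<omega> ^ k) = (\<Sum> j dvd k. c j)\<close> for \<open>f q = (\<Sum>i. r i * q ^ i)\<close>. A set built from \<open>c j / j\<close>
  orbits of length \<open>j\<close> for each \<open>j\<close> has exactly \<open>\<Sum> j dvd k. c j\<close> points fixed by \<open>\<sigma> ^ k\<close>, and its
  points of orbit length \<open>j\<close> can be labelled arbitrarily, in particular with \<open>a i j\<close> labels \<open>i\<close>
  for each \<open>i\<close>. The matrix condition then is the cyclic sieving condition. What has to be
  proved is that such orbits exist: \<open>c j = 0\<close> unless \<open>j\<close> divides \<open>n\<close>, and \<open>j\<close> divides \<open>c j\<close>.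

  The first claim is the case \<open>k = n\<close>, where \<open>f 1\<close> is the sum of all entries, while the right-hand
  side omits the columns whose index does not divide \<open>n\<close>; the entries are nonnegative, so these
  columns vanish (\<open>sieve_column_support\<close>).

  For the second claim, inverting the Fourier transform expresses sums of the integers \<open>r i\<close>
  through the rationals \<open>c j / j\<close>; after clearing denominators, the sum of \<open>(n div j) * c j\<close> over
  all \<open>j dvd n\<close> with \<open>n dvd j * m\<close> is a multiple of \<open>n\<close>, for every \<open>m\<close> (\<open>sieve_fourier\<close>). With
  \<open>m = n div d\<close> the sum ranges over the divisors of \<open>n\<close> that are multiples of \<open>d\<close>, and descending
  induction on \<open>d\<close> isolates the term of \<open>d\<close> itself (\<open>sieve_column_dvd\<close>).
\<close>

section \<open>Sums over powers of a root of unity\<close>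

lemma primitive_power_eq_1_iff:
  assumes "primitive_unity_root n \<omega>"
  shows "\<omega> ^ m = 1 \<longleftrightarrow> n dvd m"
proof -
  have n: "n \<ge> 1" "\<omega> ^ n = 1" and min: "\<And>m. 1 \<le> m \<Longrightarrow> m < n \<Longrightarrow> \<omega> ^ m \<noteq> 1"
    using assms by (auto simp: primitive_unity_root_def)
  have "\<omega> ^ m = \<omega> ^ (n * (m div n) + m mod n)"
    by simp
  also have "\<dots> = \<omega> ^ (m mod n)"
    unfolding power_add power_mult n by simp
  finally have "\<omega> ^ m = 1 \<longleftrightarrow> \<omega> ^ (m mod n) = 1"
    by simp
  also have "\<dots> \<longleftrightarrow> m mod n = 0"
    using min[of "m mod n"] n(1) by (cases "m mod n = 0") auto
  finally show ?thesis
    by (simp add: dvd_eq_mod_eq_0)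
qed

lemma sum_powers_multiples:
  assumes "primitive_unity_root n \<omega>" and "j dvd n"
  shows "(\<Sum>k\<in>{k \<in> {1..n}. j dvd k}. \<omega> ^ (k * m)) = (if n dvd j * m then of_nat (n div j) else 0)"
proof -
  define z where "z = \<omega> ^ (j * m)"
  define q where "q = n div j"
  have n: "n = j * q" and "n \<ge> 1"
    using assms by (auto simp: q_def primitive_unity_root_def)
  then have j: "j > 0"
    by (cases j) auto
  have img: "{k \<in> {1..n}. j dvd k} = (\<lambda>t. j * Suc t) ` {..<q}"
  proof (intro equalityI subsetI)
    fix k assume "k \<in> {k \<in> {1..n}. j dvd k}"
    then obtain t where t: "k = j * t" "1 \<le> j * t" "j * t \<le> j * q"
      using n by auto
    then have "t \<ge> 1" "t \<le> q"
      using j by (auto intro: Suc_leI gr0I)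
    then show "k \<in> (\<lambda>t. j * Suc t) ` {..<q}"
      using t(1) by (intro image_eqI[of _ _ "t - 1"]) auto
  next
    fix k assume "k \<in> (\<lambda>t. j * Suc t) ` {..<q}"
    then obtain t where "t < q" "k = j * Suc t"
      by auto
    then show "k \<in> {k \<in> {1..n}. j dvd k}"
      using j n mult_le_mono2[of "Suc t" q j] by auto
  qed
  have "(\<Sum>k\<in>{k \<in> {1..n}. j dvd k}. \<omega> ^ (k * m)) = (\<Sum>t<q. \<omega> ^ (j * Suc t * m))"
    unfolding img using j by (subst sum.reindex) (auto simp: inj_on_def)
  also have "\<dots> = (\<Sum>t<q. z * z ^ t)"
    by (intro sum.cong) (auto simp: z_def power_add[symmetric] power_mult[symmetric] algebra_simps)
  also have "\<dots> = z * (\<Sum>t<q. z ^ t)"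
    by (simp add: sum_distrib_left)
  also have "\<dots> = (if z = 1 then of_nat q else 0)"
  proof (cases "z = 1")
    case False
    have "z ^ q = \<omega> ^ (n * m)"
      by (simp add: z_def n power_mult[symmetric] mult.commute mult.left_commute)
    then have "z ^ q = 1"
      using primitive_power_eq_1_iff[OF assms(1)] by simp
    then show ?thesis
      using False by (simp add: geometric_sum)
  qed simp
  finally show ?thesis
    using primitive_power_eq_1_iff[OF assms(1)] by (simp add: z_def q_def)
qed

section \<open>Divisibility of the column sums\<close>

lemma sieve_column_support:
  fixes r c :: "nat \<Rightarrow> nat"
  assumes root: "primitive_unity_root n \<omega>"
    and sieve: "\<And>k. k \<in> {1..n} \<Longrightarrow>
      (\<Sum>i<n. of_nat (r i) * \<omega> ^ (k * i)) = of_nat (\<Sum>j\<in>{j \<in> {1..n}. j dvd k}. c j)"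
    and total: "(\<Sum>i<n. r i) = (\<Sum>j\<in>{1..n}. c j)"
    and j: "j \<in> {1..n}" "\<not> j dvd n"
  shows "c j = 0"
proof -
  have n: "n \<in> {1..n}" "\<omega> ^ n = 1"
    using root by (auto simp: primitive_unity_root_def)
  have "of_nat (\<Sum>i<n. r i) = (of_nat (\<Sum>j\<in>{j \<in> {1..n}. j dvd n}. c j) :: complex)"
    using sieve[OF n(1)] n(2) by (simp add: power_mult)
  then have "(\<Sum>i<n. r i) = (\<Sum>j\<in>{j \<in> {1..n}. j dvd n}. c j)"
    by (simp only: of_nat_eq_iff)
  moreover have "(\<Sum>j\<in>{1..n}. c j) =
      (\<Sum>j\<in>{1..n} - {j \<in> {1..n}. j dvd n}. c j) + (\<Sum>j\<in>{j \<in> {1..n}. j dvd n}. c j)"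
    by (rule sum.subset_diff) auto
  ultimately have "(\<Sum>j\<in>{1..n} - {j \<in> {1..n}. j dvd n}. c j) = 0"
    using total by simp
  then show ?thesis
    using j by simp
qed

text \<open>
  Both sides are \<open>\<Sum>k=1..n. \<omega> ^ (k * m) * f (\<omega> ^ k)\<close>, evaluated once from the definition of \<open>f\<close> and
  once from its prescribed values. Keeping all rows with \<open>n dvd i + m\<close> on the left avoids
  singling out the residue of \<open>-m\<close>: only the factor \<open>n\<close> matters later.
\<close>

lemma sieve_fourier:
  fixes r c :: "nat \<Rightarrow> nat"
  assumes root: "primitive_unity_root n \<omega>"
    and sieve: "\<And>k. k \<in> {1..n} \<Longrightarrow>
      (\<Sum>i<n. of_nat (r i) * \<omega> ^ (k * i)) = of_nat (\<Sum>j\<in>{j \<in> {1..n}. j dvd k}. c j)"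
    and supp: "\<And>j. j \<in> {1..n} \<Longrightarrow> \<not> j dvd n \<Longrightarrow> c j = 0"
  shows "n * (\<Sum>i\<in>{i \<in> {..<n}. n dvd i + m}. r i)
    = (\<Sum>j\<in>{j \<in> {1..n}. j dvd n \<and> n dvd j * m}. n div j * c j)"
proof -
  let ?S = "\<Sum>k\<in>{1..n}. \<omega> ^ (k * m) * (\<Sum>i<n. of_nat (r i) * \<omega> ^ (k * i))"
  have all: "{k \<in> {1..n}. 1 dvd k} = {1..n}"
    by auto
  have "?S = (\<Sum>k\<in>{1..n}. \<Sum>i<n. of_nat (r i) * \<omega> ^ (k * (i + m)))"
    by (simp add: sum_distrib_left power_add algebra_simps)
  also have "\<dots> = (\<Sum>i<n. of_nat (r i) * (\<Sum>k\<in>{1..n}. \<omega> ^ (k * (i + m))))"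
    by (subst sum.swap) (simp add: sum_distrib_left)
  also have "\<dots> = (\<Sum>i<n. if n dvd i + m then of_nat (n * r i) else 0)"
    using sum_powers_multiples[OF root one_dvd, unfolded all]
    by (intro sum.cong) auto
  also have "\<dots> = of_nat (n * (\<Sum>i\<in>{i \<in> {..<n}. n dvd i + m}. r i))"
    by (simp add: sum.inter_filter[symmetric] sum_distrib_left)
  finally have 1: "?S = of_nat (n * (\<Sum>i\<in>{i \<in> {..<n}. n dvd i + m}. r i))" .
  have "?S = (\<Sum>k\<in>{1..n}. \<omega> ^ (k * m) * (\<Sum>j\<in>{j \<in> {1..n}. j dvd k}. of_nat (c j)))"
    using sieve by (intro sum.cong) auto
  also have "\<dots> = (\<Sum>k\<in>{1..n}. \<Sum>j\<in>{j \<in> {1..n}. j dvd k}. of_nat (c j) * \<omega> ^ (k * m))"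
    by (simp add: sum_distrib_left mult.commute)
  also have "\<dots> = (\<Sum>j\<in>{1..n}. \<Sum>k\<in>{k \<in> {1..n}. j dvd k}. of_nat (c j) * \<omega> ^ (k * m))"
    by (rule sum.swap_restrict) auto
  also have "\<dots> = (\<Sum>j\<in>{1..n}. of_nat (c j) * (\<Sum>k\<in>{k \<in> {1..n}. j dvd k}. \<omega> ^ (k * m)))"
    by (simp add: sum_distrib_left)
  also have "\<dots> = (\<Sum>j\<in>{1..n}. if j dvd n \<and> n dvd j * m then of_nat (n div j * c j) else 0)"
  proof (intro sum.cong refl)
    fix j assume j: "j \<in> {1..n}"
    show "of_nat (c j) * (\<Sum>k\<in>{k \<in> {1..n}. j dvd k}. \<omega> ^ (k * m)) =
      (if j dvd n \<and> n dvd j * m then of_nat (n div j * c j) else 0)"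
    proof (cases "j dvd n")
      case True
      then show ?thesis
        by (subst sum_powers_multiples[OF root True]) simp
    qed (simp add: supp[OF j])
  qed
  also have "\<dots> = of_nat (\<Sum>j\<in>{j \<in> {1..n}. j dvd n \<and> n dvd j * m}. n div j * c j)"
    by (simp add: sum.inter_filter[symmetric])
  finally show ?thesis
    using 1 by (simp only: of_nat_eq_iff)
qed

text \<open>
  Descending induction over the divisors \<open>j\<close> of \<open>n\<close>, in the form \<open>n dvd (n div j) * c j\<close>: for
  \<open>m = n div j\<close> the condition \<open>n dvd i * m\<close> in \<open>sieve_fourier\<close> says that \<open>j\<close> divides \<open>i\<close>, so every
  summand other than that of \<open>j\<close> belongs to a larger divisor.
\<close>

lemma sieve_column_dvd:
  fixes r c :: "nat \<Rightarrow> nat"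
  assumes root: "primitive_unity_root n \<omega>"
    and sieve: "\<And>k. k \<in> {1..n} \<Longrightarrow>
      (\<Sum>i<n. of_nat (r i) * \<omega> ^ (k * i)) = of_nat (\<Sum>j\<in>{j \<in> {1..n}. j dvd k}. c j)"
    and supp: "\<And>j. j \<in> {1..n} \<Longrightarrow> \<not> j dvd n \<Longrightarrow> c j = 0"
    and j: "j \<in> {1..n}"
  shows "j dvd c j"
proof (cases "j dvd n")
  case False
  then show ?thesis
    using supp[OF j] by simp
next
  case True
  have n: "n > 0"
    using j by simp
  have "n dvd n div j * c j" if "j dvd n" for j
    using that
  proof (induction "n - j" arbitrary: j rule: less_induct)
    case less
    let ?J = "{j' \<in> {1..n}. j' dvd n \<and> n dvd j' * (n div j)}"
    obtain q where q: "n = j * q"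
      using less.prems by blast
    have j: "j > 0" "j \<le> n" and nj: "n div j = q" and "q > 0"
      using q n by auto
    then have "j \<in> ?J"
      using q by auto
    have "n dvd n div i * c i" if i: "i \<in> ?J - {j}" for i
    proof -
      have "j dvd i"
        using i \<open>q > 0\<close> unfolding nj by (auto simp: q)
      then have "j < i"
        using i by (auto dest!: dvd_imp_le)
      then show ?thesis
        using i j by (intro less.hyps) auto
    qed
    then have "n dvd (\<Sum>i\<in>?J - {j}. n div i * c i)"
      by (rule dvd_sum)
    moreover have "n * (\<Sum>i\<in>{i \<in> {..<n}. n dvd i + n div j}. r i) = (\<Sum>i\<in>?J. n div i * c i)"
      by (rule sieve_fourier[OF root sieve supp])
    then have "n dvd (\<Sum>i\<in>?J. n div i * c i)"
      by (metis dvd_triv_left)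
    moreover have "(\<Sum>i\<in>?J. n div i * c i) = n div j * c j + (\<Sum>i\<in>?J - {j}. n div i * c i)"
      using \<open>j \<in> ?J\<close> by (intro sum.remove) auto
    ultimately show ?case
      by (simp only: dvd_add_left_iff)
  qed
  from this[OF True] show ?thesis
    using True n by (auto elim!: dvdE)
qed

section \<open>Actions of a cyclic group\<close>

lemma cyclic_gen_powers:
  assumes "cyclic_gen C \<sigma> n" and "n \<ge> 1"
  shows "carrier C = range (\<lambda>m::nat. \<sigma> [^]\<^bsub>C\<^esub> m)"
    and "\<And>k l::int. \<sigma> [^]\<^bsub>C\<^esub> k = \<sigma> [^]\<^bsub>C\<^esub> l \<longleftrightarrow> int n dvd l - k"
proof -
  interpret group C
    using assms by (simp add: cyclic_gen_def)
  have \<sigma>: "\<sigma> \<in> carrier C" and gen: "carrier C = generate C {\<sigma>}" and "order C = n"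
    using assms(1) unfolding cyclic_gen_def by blast+
  then have ord: "ord \<sigma> = n"
    using generate_pow_card[OF \<sigma>] by (simp add: order_def)
  show "carrier C = range (\<lambda>m::nat. \<sigma> [^]\<^bsub>C\<^esub> m)"
    using generate_pow_nat[OF \<sigma>] ord assms(2) gen by auto
  show "\<And>k l::int. \<sigma> [^]\<^bsub>C\<^esub> k = \<sigma> [^]\<^bsub>C\<^esub> l \<longleftrightarrow> int n dvd l - k"
    using int_pow_eq[OF \<sigma>] ord by simp
qed

text \<open>
  An action of a cyclic group is determined by its generator. Giving the powers of the generator
  as a family \<open>act\<close> over the naturals, instead of iterating one permutation, lets an explicit
  formula for the powers be used directly.
\<close>

lemma periodic_action_extends:
  fixes act :: "nat \<Rightarrow> 'x \<Rightarrow> 'x" and C :: "('g, 'b) monoid_scheme"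
  assumes C: "cyclic_gen C \<sigma> n" "n \<ge> 1"
    and closed: "\<And>m x. x \<in> X \<Longrightarrow> act m x \<in> X"
    and zero: "\<And>x. x \<in> X \<Longrightarrow> act 0 x = x"
    and period: "\<And>x. x \<in> X \<Longrightarrow> act n x = x"
    and add: "\<And>l m x. x \<in> X \<Longrightarrow> act (l + m) x = act l (act m x)"
  obtains \<phi> where "group_action C X \<phi>" and "\<And>m x. x \<in> X \<Longrightarrow> \<phi> (\<sigma> [^]\<^bsub>C\<^esub> (m::nat)) x = act m x"
proof -
  interpret C: group C
    using C by (simp add: cyclic_gen_def)
  have \<sigma>: "\<sigma> \<in> carrier C"
    using C(1) unfolding cyclic_gen_def by blast
  note pow = cyclic_gen_powers[OF C]
  have mult: "act (n * q) x = x" if "x \<in> X" for q x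
    by (induction q) (auto simp: add zero period that)
  have mod: "act m x = act (m mod n) x" if "x \<in> X" for m x
    using add[OF that, of "m mod n" "n * (m div n)"] mult[OF that] by simp
  define e where "e g = (SOME m::nat. g = \<sigma> [^]\<^bsub>C\<^esub> m)" for g
  define \<phi> where "\<phi> g = (\<lambda>x\<in>X. act (e g) x)" for g
  have \<phi>_pow: "\<phi> (\<sigma> [^]\<^bsub>C\<^esub> m) x = act m x" if x: "x \<in> X" for m :: nat and x
  proof -
    have "\<sigma> [^]\<^bsub>C\<^esub> m = \<sigma> [^]\<^bsub>C\<^esub> e (\<sigma> [^]\<^bsub>C\<^esub> m)"
      unfolding e_def by (rule someI) simp
    then have "int n dvd int (e (\<sigma> [^]\<^bsub>C\<^esub> m)) - int m"
      using pow(2)[of "int m" "int (e (\<sigma> [^]\<^bsub>C\<^esub> m))"] by (simp add: int_pow_int)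
    then have "e (\<sigma> [^]\<^bsub>C\<^esub> m) mod n = m mod n"
      by (metis mod_eq_dvd_iff of_nat_eq_iff of_nat_mod)
    then show ?thesis
      using mod[OF x] x by (metis \<phi>_def restrict_apply')
  qed
  have bij: "\<phi> g \<in> Bij X" if gC: "g \<in> carrier C" for g
  proof -
    obtain m where g: "g = \<sigma> [^]\<^bsub>C\<^esub> (m::nat)"
      using gC unfolding pow(1) by blast
    \<comment> \<open>\<open>n * m - m\<close> is a natural number congruent to \<open>-m\<close> modulo \<open>n\<close>.\<close>
    have inv: "act (n * m - m) (act m x) = x" "act m (act (n * m - m) x) = x" if "x \<in> X" for x
      using add[OF that, of "n * m - m" m] add[OF that, of m "n * m - m"] mult[OF that, of m] C(2)
      by simp_all
    have "bij_betw (\<phi> g) X X"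
      by (rule bij_betw_byWitness[where f' = "act (n * m - m)"]) (auto simp: g \<phi>_pow inv closed)
    then show ?thesis
      by (simp add: Bij_def \<phi>_def)
  qed
  have "\<phi> \<in> hom C (BijGroup X)"
  proof (rule homI)
    fix g h assume gh: "g \<in> carrier C" "h \<in> carrier C"
    then obtain l m :: nat where l: "g = \<sigma> [^]\<^bsub>C\<^esub> l" and m: "h = \<sigma> [^]\<^bsub>C\<^esub> m"
      unfolding pow(1) by blast
    have "\<phi> (g \<otimes>\<^bsub>C\<^esub> h) = compose X (\<phi> g) (\<phi> h)"
    proof (rule extensionalityI[of _ X])
      fix x assume "x \<in> X"
      then show "\<phi> (g \<otimes>\<^bsub>C\<^esub> h) x = compose X (\<phi> g) (\<phi> h) x"
        by (simp add: l m C.nat_pow_mult \<sigma> \<phi>_pow compose_def add closed)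
    qed (auto simp: \<phi>_def)
    then show "\<phi> (g \<otimes>\<^bsub>C\<^esub> h) = \<phi> g \<otimes>\<^bsub>BijGroup X\<^esub> \<phi> h"
      using bij gh by (simp add: BijGroup_def)
  qed (use bij in \<open>simp add: BijGroup_def\<close>)
  then have "group_action C X \<phi>"
    by (simp add: group_action_def group_hom_def group_hom_axioms_def group_BijGroup)
  then show thesis
    using \<phi>_pow that by blast
qed

section \<open>Orbits of prescribed length and statistics with prescribed fibres\<close>

text \<open>
  The naturals are cut into the blocks \<open>{j * q ..< j * q + j}\<close>, and each block is rotated by \<open>m\<close>
  steps. A step of one is thus a permutation all of whose cycles have length \<open>j\<close>, and it preserves
  \<open>{..<c}\<close> when \<open>j\<close> divides \<open>c\<close>.
\<close>

definition rotate_blocks :: "nat \<Rightarrow> nat \<Rightarrow> nat \<Rightarrow> nat" where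
  "rotate_blocks j m x = j * (x div j) + (x + m) mod j"

lemma rotate_blocks_less:
  assumes "j > 0" "j dvd c" "x < c"
  shows "rotate_blocks j m x < c"
proof -
  obtain q where q: "c = j * q"
    using assms by blast
  have "x div j < q"
    using assms q by (simp add: div_less_iff_less_mult mult.commute)
  have "rotate_blocks j m x < j * (x div j) + j"
    using assms by (simp add: rotate_blocks_def)
  also have "\<dots> = j * Suc (x div j)"
    by simp
  also have "\<dots> \<le> c"
    unfolding q using \<open>x div j < q\<close> by (intro mult_le_mono2) simp
  finally show ?thesis .
qed

lemma rotate_blocks_add:
  assumes "j > 0"
  shows "rotate_blocks j (l + m) x = rotate_blocks j l (rotate_blocks j m x)"
proof -
  have "(j * (x div j) + (x + m) mod j) div j = x div j"
    using assms by simp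
  moreover have "(j * (x div j) + (x + m) mod j + l) mod j = (x + (l + m)) mod j"
    by (simp add: mod_simps add.assoc) (simp add: add.commute add.left_commute)
  ultimately show ?thesis
    by (simp add: rotate_blocks_def)
qed

lemma rotate_blocks_fixed_iff:
  "rotate_blocks j m x = x \<longleftrightarrow> j dvd m"
proof -
  have "rotate_blocks j m x = x \<longleftrightarrow> (x + m) mod j = x mod j"
    unfolding rotate_blocks_def using mult_div_mod_eq[of j x] by linarith
  also have "\<dots> \<longleftrightarrow> j dvd m"
    using mod_eq_dvd_iff_nat[of x "x + m" j] by (simp add: eq_commute)
  finally show ?thesis .
qed

lemma labelling_with_fibre_sizes:
  fixes a :: "'i \<Rightarrow> nat"
  assumes "finite I"
  obtains t where "\<And>x. x < sum a I \<Longrightarrow> t x \<in> I"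
    and "\<And>i. i \<in> I \<Longrightarrow> card {x. x < sum a I \<and> t x = i} = a i"
proof -
  have "card (SIGMA i:I. {..<a i}) = sum a I"
    using assms by simp
  then obtain h where h: "bij_betw h {0..<sum a I} (SIGMA i:I. {..<a i})"
    using ex_bij_betw_nat_finite[of "SIGMA i:I. {..<a i}"] assms by auto
  show thesis
  proof (rule that[of "fst \<circ> h"])
    fix x assume "x < sum a I"
    then have "h x \<in> (SIGMA i:I. {..<a i})"
      using bij_betwE[OF h] by simp
    then show "(fst \<circ> h) x \<in> I"
      by auto
  next
    fix i assume i: "i \<in> I"
    have "h ` {x. x < sum a I \<and> (fst \<circ> h) x = i} = {y \<in> h ` {0..<sum a I}. fst y = i}"
      by auto
    also have "\<dots> = {i} \<times> {..<a i}"
      using h i by (auto simp: bij_betw_def)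
    finally have "card (h ` {x. x < sum a I \<and> (fst \<circ> h) x = i}) = a i"
      by simp
    moreover have "inj_on h {x. x < sum a I \<and> (fst \<circ> h) x = i}"
      using h by (auto simp: bij_betw_def inj_on_def)
    ultimately show "card {x. x < sum a I \<and> (fst \<circ> h) x = i} = a i"
      by (simp add: card_image)
  qed
qed

section \<open>Realizing the matrix\<close>

text \<open>
  The points are the pairs \<open>(j, x)\<close> with \<open>x < c j\<close>, encoded as naturals. The generator rotates the
  blocks of length \<open>j\<close> in the \<open>j\<close>-th component, so \<open>j\<close> is the orbit length of \<open>(j, x)\<close>; the period \<open>n\<close>
  is respected because only components with \<open>j dvd n\<close> are nonempty. The statistic is chosen
  separately on each component, regardless of the action.
\<close>

lemma action_with_matrix:
  fixes a :: "nat \<Rightarrow> nat \<Rightarrow> nat" and C :: "('g, 'b) monoid_scheme"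
  assumes C: "cyclic_gen C \<sigma> n" "n \<ge> 1"
    and dvd: "\<And>j. j \<in> {1..n} \<Longrightarrow> j dvd (\<Sum>i<n. a i j)"
    and supp: "\<And>j. j \<in> {1..n} \<Longrightarrow> \<not> j dvd n \<Longrightarrow> (\<Sum>i<n. a i j) = 0"
  obtains X :: "nat set" and \<phi> \<tau> where "finite X" "group_action C X \<phi>"
    and "\<And>z. stat_gf X \<tau> z = (\<Sum>j\<in>{1..n}. \<Sum>i<n. of_nat (a i j) * z ^ i)"
    and "\<And>k::nat. card (invariants X \<phi> (\<sigma> [^]\<^bsub>C\<^esub> k)) = (\<Sum>j\<in>{j \<in> {1..n}. j dvd k}. \<Sum>i<n. a i j)"
    and "csp_matrix n C \<sigma> X \<phi> \<tau> = (\<lambda>(i, j)\<in>mat_index n. real (a i j))"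
proof -
  define c where "c j = (\<Sum>i<n. a i j)" for j
  have "\<exists>t. (\<forall>x<c j. t x \<in> {..<n}) \<and> (\<forall>i\<in>{..<n}. card {x. x < c j \<and> t x = i} = a i j)" for j
    unfolding c_def by (rule labelling_with_fibre_sizes[of "{..<n}" "\<lambda>i. a i j"]) auto
  then obtain t where t: "\<And>j x. x < c j \<Longrightarrow> t j x < n"
    and fibre: "\<And>i j. i < n \<Longrightarrow> card {x. x < c j \<and> t j x = i} = a i j"
    by (metis lessThan_iff)
  define Y where "Y = (SIGMA j:{1..n}. {..<c j})"
  define X where "X = prod_encode ` Y"
  define act where "act m y = (case prod_decode y of (j, x) \<Rightarrow> prod_encode (j, rotate_blocks j m x))" for m y
  define \<tau> where "\<tau> y = (case prod_decode y of (j, x) \<Rightarrow> t j x)" for y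
  have act [simp]: "act m (prod_encode (j, x)) = prod_encode (j, rotate_blocks j m x)" for m j x
    by (simp add: act_def)
  have \<tau> [simp]: "\<tau> (prod_encode (j, x)) = t j x" for j x
    by (simp add: \<tau>_def)
  have Y: "j > 0" "j \<le> n" "j dvd c j" "j dvd n" "x < c j" if "(j, x) \<in> Y" for j x
  proof -
    have j: "j \<in> {1..n}" and x: "x < c j"
      using that by (auto simp: Y_def)
    then show "j > 0" "j \<le> n" "x < c j" "j dvd c j"
      using dvd[of j] by (auto simp: c_def)
    show "j dvd n"
      using x supp[OF j, folded c_def] by (cases "j dvd n") auto
  qed
  have closed: "act m y \<in> X" and zero: "act 0 y = y" and period: "act n y = y"
    and add: "act (l + m) y = act l (act m y)" if yX: "y \<in> X" for l m y
  proof -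
    obtain j x where y: "y = prod_encode (j, x)" and jx: "(j, x) \<in> Y"
      using yX by (auto simp: X_def)
    note Yjx = Y[OF jx]
    show "act m y \<in> X"
      using rotate_blocks_less[OF Yjx(1,3,5)] jx by (auto simp: X_def y Y_def)
    show "act 0 y = y" "act n y = y"
      using Yjx(4) by (simp_all add: y rotate_blocks_fixed_iff)
    show "act (l + m) y = act l (act m y)"
      by (simp add: y rotate_blocks_add[OF Yjx(1)])
  qed
  obtain \<phi> where \<phi>: "group_action C X \<phi>"
    and \<phi>_pow: "\<And>m y. y \<in> X \<Longrightarrow> \<phi> (\<sigma> [^]\<^bsub>C\<^esub> (m::nat)) y = act m y"
    using periodic_action_extends[where X = X and act = act, OF C closed zero period add] by blast
  have fixed: "\<phi> (\<sigma> [^]\<^bsub>C\<^esub> m) (prod_encode (j, x)) = prod_encode (j, x) \<longleftrightarrow> j dvd m"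
    if "(j, x) \<in> Y" for m :: nat and j x
    using that by (simp add: X_def \<phi>_pow rotate_blocks_fixed_iff prod_encode_eq)
  have orbit: "orbit_len n C \<sigma> \<phi> (prod_encode (j, x)) = j" if "(j, x) \<in> Y" for j x
    unfolding orbit_len_def fixed[OF that]
    using Y[OF that] by (intro Min_eqI) (auto dest: dvd_imp_le)
  have inj: "inj_on prod_encode S" for S
    by (rule inj_prod_encode)
  show thesis
  proof (rule that[of X \<phi> \<tau>])
    show "finite X"
      by (simp add: X_def Y_def)
    show "group_action C X \<phi>"
      by (fact \<phi>)
    fix z :: complex
    have "stat_gf X \<tau> z = (\<Sum>(j, x)\<in>Y. z ^ t j x)"
      unfolding stat_gf_def X_def by (subst sum.reindex[OF inj]) (auto intro: sum.cong)
    also have "\<dots> = (\<Sum>j\<in>{1..n}. \<Sum>x<c j. z ^ t j x)"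
      unfolding Y_def by (subst sum.Sigma) auto
    also have "\<dots> = (\<Sum>j\<in>{1..n}. \<Sum>i<n. of_nat (a i j) * z ^ i)"
    proof (rule sum.cong[OF refl])
      fix j
      have "(\<Sum>x<c j. z ^ t j x) = (\<Sum>i<n. \<Sum>x\<in>{x \<in> {..<c j}. t j x = i}. z ^ t j x)"
        by (rule sum.group[symmetric]) (auto simp: t)
      also have "\<dots> = (\<Sum>i<n. of_nat (a i j) * z ^ i)"
        by (intro sum.cong refl) (simp add: fibre)
      finally show "(\<Sum>x<c j. z ^ t j x) = (\<Sum>i<n. of_nat (a i j) * z ^ i)" .
    qed
    finally show "stat_gf X \<tau> z = (\<Sum>j\<in>{1..n}. \<Sum>i<n. of_nat (a i j) * z ^ i)" .
  next
    fix k :: nat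
    have "invariants X \<phi> (\<sigma> [^]\<^bsub>C\<^esub> k) = prod_encode ` {(j, x) \<in> Y. j dvd k}"
      unfolding invariants_def X_def by (auto simp: fixed)
    also have "{(j, x) \<in> Y. j dvd k} = (SIGMA j:{j \<in> {1..n}. j dvd k}. {..<c j})"
      by (auto simp: Y_def)
    finally show "card (invariants X \<phi> (\<sigma> [^]\<^bsub>C\<^esub> k)) = (\<Sum>j\<in>{j \<in> {1..n}. j dvd k}. \<Sum>i<n. a i j)"
      by (simp add: card_image[OF inj] c_def)
  next
    have "card {y \<in> X. \<tau> y mod n = i mod n \<and> orbit_len n C \<sigma> \<phi> y = j} = a i j"
      if "(i, j) \<in> mat_index n" for i j
    proof -
      have ij: "i < n" "j \<in> {1..n}"
        using that by (auto simp: mat_index_def)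
      have "{y \<in> X. \<tau> y mod n = i mod n \<and> orbit_len n C \<sigma> \<phi> y = j}
          = prod_encode ` {(j', x) \<in> Y. t j' x = i \<and> j' = j}"
        unfolding X_def using ij(1) by (auto simp: orbit t Y)
      also have "{(j', x) \<in> Y. t j' x = i \<and> j' = j} = {j} \<times> {x. x < c j \<and> t j x = i}"
        using ij(2) by (auto simp: Y_def)
      finally show ?thesis
        using ij by (simp add: card_image[OF inj] fibre)
    qed
    then show "csp_matrix n C \<sigma> X \<phi> \<tau> = (\<lambda>(i, j)\<in>mat_index n. real (a i j))"
      unfolding csp_matrix_def by (intro restrict_ext) auto
  qed
qed

section \<open>Integer matrices with the sieving property\<close>

theorem lemma5p1:
  fixes n :: nat and \<omega> :: complex and C :: "('g, 'b) monoid_scheme" and \<sigma> :: 'g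
    and A :: "nat \<times> nat \<Rightarrow> real"
  assumes "n \<ge> 1"
    and "primitive_unity_root n \<omega>"
    and "cyclic_gen C \<sigma> n"
    and "A \<in> CSP_int n \<omega>"
  shows "\<exists>(X :: nat set) (\<phi> :: 'g \<Rightarrow> nat \<Rightarrow> nat) (\<tau> :: nat \<Rightarrow> nat).
    finite X \<and> group_action C X \<phi> \<and>
    exhibits_csp \<omega> C \<sigma> X \<phi> \<tau> \<and>
    csp_matrix n C \<sigma> X \<phi> \<tau> = A"
proof -
  define a where "a i j = nat \<lfloor>A (i, j)\<rfloor>" for i j
  define r where "r i = (\<Sum>j\<in>{1..n}. a i j)" for i
  define c where "c j = (\<Sum>i<n. a i j)" for j
  have A: "A \<in> mat_index n \<rightarrow>\<^sub>E {0..}" "A \<in> mat_index n \<rightarrow>\<^sub>E \<int>"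
    and csp: "\<And>k. k \<in> {1..n} \<Longrightarrow>
       (\<Sum>(i, j)\<in>mat_index n. complex_of_real (A (i, j)) * \<omega> ^ (k * i)) =
       complex_of_real (\<Sum>i\<in>{0..<n}. \<Sum>j\<in>{j \<in> {1..n}. j dvd k}. A (i, j))"
    using assms(4) by (auto simp: CSP_int_def CSP_def)
  have a: "A (i, j) = real (a i j)" if "i < n" "j \<in> {1..n}" for i j
  proof -
    have "(i, j) \<in> mat_index n"
      using that by (simp add: mat_index_def)
    then have "A (i, j) \<ge> 0" "A (i, j) \<in> \<int>"
      using A by (auto simp: PiE_def Pi_def)
    then show ?thesis
      by (auto simp: a_def elim!: Ints_cases)
  qed
  have rows: "(\<Sum>i<n. of_nat (r i) * z i) = (\<Sum>j\<in>{1..n}. \<Sum>i<n. of_nat (a i j) * z i)"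
    for z :: "nat \<Rightarrow> complex"
    unfolding r_def by (subst sum.swap) (simp add: sum_distrib_right)
  have sieve: "(\<Sum>i<n. of_nat (r i) * \<omega> ^ (k * i)) = of_nat (\<Sum>j\<in>{j \<in> {1..n}. j dvd k}. c j)"
    if "k \<in> {1..n}" for k
  proof -
    have "(\<Sum>i<n. of_nat (r i) * \<omega> ^ (k * i)) = (\<Sum>i<n. \<Sum>j\<in>{1..n}. of_nat (a i j) * \<omega> ^ (k * i))"
      by (simp add: r_def sum_distrib_right)
    also have "\<dots> = (\<Sum>(i, j)\<in>mat_index n. complex_of_real (A (i, j)) * \<omega> ^ (k * i))"
      unfolding mat_index_def sum.cartesian_product[symmetric] atLeast0LessThan
      by (intro sum.cong refl) (simp add: a)
    also have "\<dots> = complex_of_real (\<Sum>i<n. \<Sum>j\<in>{j \<in> {1..n}. j dvd k}. A (i, j))"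
      using csp[OF that] by (simp only: atLeast0LessThan)
    also have "(\<Sum>i<n. \<Sum>j\<in>{j \<in> {1..n}. j dvd k}. A (i, j))
        = (\<Sum>i<n. \<Sum>j\<in>{j \<in> {1..n}. j dvd k}. real (a i j))"
      by (intro sum.cong refl) (simp add: a)
    also have "\<dots> = real (\<Sum>j\<in>{j \<in> {1..n}. j dvd k}. c j)"
      unfolding c_def by (subst sum.swap) simp
    finally show ?thesis
      by simp
  qed
  have total: "(\<Sum>i<n. r i) = (\<Sum>j\<in>{1..n}. c j)"
    unfolding r_def c_def by (rule sum.swap)
  have supp: "c j = 0" if "j \<in> {1..n}" "\<not> j dvd n" for j
    using assms(2) sieve total that by (rule sieve_column_support)
  have dvd: "j dvd c j" if "j \<in> {1..n}" for j
    using assms(2) sieve supp that by (rule sieve_column_dvd)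
  obtain X :: "nat set" and \<phi> \<tau> where X: "finite X" "group_action C X \<phi>"
    and gf: "\<And>z. stat_gf X \<tau> z = (\<Sum>j\<in>{1..n}. \<Sum>i<n. of_nat (a i j) * z ^ i)"
    and inv: "\<And>k::nat. card (invariants X \<phi> (\<sigma> [^]\<^bsub>C\<^esub> k)) = (\<Sum>j\<in>{j \<in> {1..n}. j dvd k}. c j)"
    and mat: "csp_matrix n C \<sigma> X \<phi> \<tau> = (\<lambda>(i, j)\<in>mat_index n. real (a i j))"
    by (rule action_with_matrix[OF assms(3,1), of a, folded c_def, OF dvd supp]) (assumption | rule that)+
  have "csp_matrix n C \<sigma> X \<phi> \<tau> = A"
  proof (rule extensionalityI[of _ "mat_index n"])
    fix p assume "p \<in> mat_index n"
    then show "csp_matrix n C \<sigma> X \<phi> \<tau> p = A p"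
      by (auto simp: mat a mat_index_def)
  qed (use A(1) in \<open>auto simp: mat PiE_def\<close>)
  moreover have "stat_gf X \<tau> (\<omega> powi k) = of_nat (card (invariants X \<phi> (\<sigma> [^]\<^bsub>C\<^esub> k)))" for k :: int
  proof -
    \<comment> \<open>The matrix condition covers exponents from \<open>1\<close> to \<open>n\<close>, so the representative of \<open>k\<close> modulo \<open>n\<close>
      is taken there: the shift by one sends multiples of \<open>n\<close> to \<open>n\<close> and not to \<open>0\<close>.\<close>
    define l where "l = nat ((k - 1) mod int n) + 1"
    have "int l = (k - 1) mod int n + 1"
      using assms(1) by (simp add: l_def)
    moreover have "(k - 1) mod int n < int n"
      using assms(1) by simp
    ultimately have "int l \<le> int n" and "k = int l + int n * ((k - 1) div int n)"
      using mult_div_mod_eq[of "int n" "k - 1"] by linarith+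
    moreover have "l \<ge> 1"
      by (simp add: l_def)
    ultimately have l: "l \<in> {1..n}"
      by simp
    obtain q where k: "k = int l + int n * q"
      using \<open>k = int l + int n * ((k - 1) div int n)\<close> by blast
    have \<omega>: "\<omega> ^ n = 1" "\<omega> \<noteq> 0"
      using assms(1,2) by (auto simp: primitive_unity_root_def power_0_left)
    then have "\<omega> powi k = \<omega> ^ l"
      unfolding k by (simp add: power_int_add power_int_mult)
    moreover have "\<sigma> [^]\<^bsub>C\<^esub> k = \<sigma> [^]\<^bsub>C\<^esub> l"
      using cyclic_gen_powers(2)[OF assms(3,1), of k "int l"] by (simp add: k int_pow_int)
    moreover have "stat_gf X \<tau> (\<omega> ^ l) = of_nat (card (invariants X \<phi> (\<sigma> [^]\<^bsub>C\<^esub> l)))"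
      using sieve[OF l] rows[of "\<lambda>i. \<omega> ^ (l * i)"] by (simp add: gf inv power_mult)
    ultimately show ?thesis
      by simp
  qed
  ultimately show ?thesis
    using X unfolding exhibits_csp_def by blast
qed

end
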